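(* For all positive integers $m$ and $k$, $$\begin{aligned} &(-1)^m\zeta\left(\bar1,\{1\}_{m-1},3,\{1\}_{k-1}\right)+(-1)^k\zeta\left(\bar1,\{1\}_{k-1},3,\{1\}_{m-1}\right)\\ &=\frac{(-1)^{m+1}}{m!}(\ln2)^m\,\zeta\left(\bar3,\{1\}_{k-1}\right)+\frac{(-1)^{k+1}}{k!}(\ln2)^k\,\zeta\left(\bar3,\{1\}_{m-1}\right)+\zeta\left(\bar2,\{1\}_{m-1}\right)\zeta\left(\bar2,\{1\}_{k-1}\right)\\ &\quad+(-1)^{m+1}\sum_{i=1}^{m-1}\frac{(\ln2)^i}{i!}\,\zeta\left(\bar1,\{1\}_{m-i-1},3,\{1\}_{k-1}\right)+(-1)^{k+1}\sum_{i=1}^{k-1}\frac{(\ln2)^i}{i!}\,\zeta\left(\bar1,\{1\}_{k-i-1},3,\{1\}_{m-1}\right). \end{aligned}$$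
   Context: Notation. $\{1\}_r$ denotes the string of $r$ entries equal to $1$ (empty if $r=0$). For positive integers $s_1,\dots,s_r$, $\zeta(s_1,\dots,s_r):=\lim_{n\to\infty}\sum_{n\ge k_1>\cdots>k_r\ge1}\frac{1}{k_1^{s_1}\cdots k_r^{s_r}}$. A bar over an entry $s_j$ means that the factor $(-1)^{k_j}$ is inserted in the summand; e.g. $\zeta(\bar1,\{1\}_{m-1},3,\{1\}_{k-1})=\lim_{n\to\infty}\sum_{n\ge k_1>\cdots>k_{m+k}\ge1}\frac{(-1)^{k_1}}{k_1\cdots k_m\,k_{m+1}^3\,k_{m+2}\cdots k_{m+k}}$. Sums over empty ranges are $0$. *)

theory Defs
  imports "HOL-Analysis.Analysis"
begin

text \<open>An entry of the argument string of an alternating multiple zeta value: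
  \<open>Plain s\<close> is \<open>s\<close>, and \<open>Bar s\<close> is \<open>s\<close> with a bar over it.\<close>

datatype zeta_entry = Plain nat | Bar nat

fun entry_term :: "zeta_entry \<Rightarrow> nat \<Rightarrow> real" where
  "entry_term (Plain s) k = 1 / real k ^ s"
| "entry_term (Bar s) k = (-1) ^ k / real k ^ s"

text \<open>The index lists \<open>[k\<^sub>1, \<dots>, k\<^sub>r]\<close> with \<open>n \<ge> k\<^sub>1 > \<dots> > k\<^sub>r \<ge> 1\<close>.\<close>

definition decreasing_indices :: "nat \<Rightarrow> nat \<Rightarrow> nat list set" where
  "decreasing_indices r n = {ks. length ks = r \<and> sorted_wrt (>) ks \<and> set ks \<subseteq> {1..n}}"

definition zeta_partial :: "zeta_entry list \<Rightarrow> nat \<Rightarrow> real" where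
  "zeta_partial ss n =
     (\<Sum>ks\<in>decreasing_indices (length ss) n. \<Prod>j<length ss. entry_term (ss ! j) (ks ! j))"

text \<open>The limit is taken along the outer cutoff \<open>n\<close>, because a string with leading
  entry \<open>Bar 1\<close> gives only a conditionally convergent series.\<close>

definition mzeta :: "zeta_entry list \<Rightarrow> real" where
  "mzeta ss = lim (zeta_partial ss)"

abbreviation ones :: "nat \<Rightarrow> zeta_entry list" where
  "ones r \<equiv> replicate r (Plain 1)"

end

theory Submission
  imports Defs
begin

text \<open>Write \<open>Li\<close> for multiple polylogarithms in one variable and \<open>A\<^sub>i(x) = (-ln (1 - x))\<^sup>i / i!\<close>,
  which is \<open>Li\<close> of a string of \<open>i\<close> ones. Let \<open>P\<^sub>k\<close> and \<open>R\<^sub>j\<^sub>,\<^sub>k\<close> be \<open>Li\<close> of the strings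
  \<open>2,{1}\<close> and \<open>{1},3,{1}\<close>, with \<open>k - 1\<close> final and \<open>j\<close> initial ones. Repeated integration by parts shows that
  \<open>\<Sum>j\<le>m. (-1)\<^sup>j A\<^bsub>m - j\<^esub> R\<^bsub>j,k\<^esub>\<close> is a primitive of \<open>A\<^sub>m P\<^sub>k / x\<close>. Together with
  its mirror image under exchange of \<open>m\<close> and \<open>k\<close> it therefore equals \<open>P\<^sub>m P\<^sub>k\<close>, and
  the theorem is this identity at \<open>x = -1\<close>. All functions involved are continuous on
  \<open>[-1, 0]\<close> because their coefficients tend to \<open>0\<close> and have bounded variation.\<close>

section \<open>Multiple polylogarithms\<close>

text \<open>The coefficient of \<open>x ^ n\<close> gathers the terms of the nested sum with largest
  index \<open>n\<close>. Giving the empty string the sole index \<open>0\<close> lets the strict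
  bound \<open>j < n\<close> also encode that the last index is at least 1.\<close>

primrec mpl_coeff :: "nat list \<Rightarrow> nat \<Rightarrow> real" where
  "mpl_coeff [] n = (if n = 0 then 1 else 0)"
| "mpl_coeff (s # ss) n = (if n = 0 then 0 else (\<Sum>j<n. mpl_coeff ss j) / real n ^ s)"

definition mpl :: "nat list \<Rightarrow> real \<Rightarrow> real" where
  "mpl ss x = (\<Sum>n. mpl_coeff ss n * x ^ n)"

lemma mpl_coeff_nonneg: "0 \<le> mpl_coeff ss n"
  by (induction ss arbitrary: n) (auto intro!: divide_nonneg_nonneg sum_nonneg)

lemma mpl_at_0: "mpl ss 0 = mpl_coeff ss 0"
  unfolding mpl_def by simp

section \<open>Truncated zeta sums as partial sums of power series\<close>

lemma decreasing_indices_0: "decreasing_indices 0 n = {[]}"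
  by (auto simp: decreasing_indices_def)

text \<open>Splitting off the largest index turns a sum over index lists into a recursion on the
  string, the form that \<open>mpl_coeff\<close> has.\<close>

lemma decreasing_indices_Suc:
  "decreasing_indices (Suc r) n =
     (\<lambda>(k, ks). k # ks) ` (SIGMA k:{1..n}. decreasing_indices r (k - 1))"
proof (intro equalityI subsetI)
  fix xs assume xs: "xs \<in> decreasing_indices (Suc r) n"
  then obtain k ks where "xs = k # ks"
    by (auto simp: decreasing_indices_def length_Suc_conv)
  moreover from this xs have "k \<in> {1..n}" "ks \<in> decreasing_indices r (k - 1)"
    by (fastforce simp: decreasing_indices_def)+
  ultimately show "xs \<in> (\<lambda>(k, ks). k # ks) ` (SIGMA k:{1..n}. decreasing_indices r (k - 1))"
    by force
qed (fastforce simp: decreasing_indices_def)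

lemma finite_decreasing_indices: "finite (decreasing_indices r n)"
  by (induction r arbitrary: n) (simp_all add: decreasing_indices_0 decreasing_indices_Suc)

lemma zeta_partial_Nil: "zeta_partial [] n = 1"
  by (simp add: zeta_partial_def decreasing_indices_0)

lemma zeta_partial_Cons:
  "zeta_partial (e # es) n = (\<Sum>k=1..n. entry_term e k * zeta_partial es (k - 1))"
proof -
  have inj: "inj_on (\<lambda>(k, ks). k # ks) (SIGMA k:{1..n}. decreasing_indices (length es) (k - 1))"
    by (auto simp: inj_on_def)
  have "zeta_partial (e # es) n =
      (\<Sum>(k, ks)\<in>(SIGMA k:{1..n}. decreasing_indices (length es) (k - 1)).
         \<Prod>j<Suc (length es). entry_term ((e # es) ! j) ((k # ks) ! j))"
    unfolding zeta_partial_def list.size add_0_right add_Suc_right decreasing_indices_Suc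
    by (subst sum.reindex[OF inj]) (simp add: case_prod_unfold)
  also have "\<dots> = (\<Sum>(k, ks)\<in>(SIGMA k:{1..n}. decreasing_indices (length es) (k - 1)).
         entry_term e k * (\<Prod>j<length es. entry_term (es ! j) (ks ! j)))"
    by (simp only: prod.lessThan_Suc_shift nth_Cons_0 nth_Cons_Suc)
  also have "\<dots> = (\<Sum>k=1..n. entry_term e k * zeta_partial es (k - 1))"
    by (subst sum.Sigma[symmetric])
       (simp_all add: finite_decreasing_indices zeta_partial_def sum_distrib_left)
  finally show ?thesis .
qed

lemma zeta_partial_Plain: "zeta_partial (map Plain ss) n = (\<Sum>j\<le>n. mpl_coeff ss j)"
proof (induction ss arbitrary: n)
  case Nil
  then show ?case by (simp add: zeta_partial_Nil)
next
  case (Cons s ss)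
  have "zeta_partial (map Plain (s # ss)) n =
      (\<Sum>k=1..n. entry_term (Plain s) k * (\<Sum>j\<le>k - 1. mpl_coeff ss j))"
    by (simp add: zeta_partial_Cons Cons.IH)
  also have "\<dots> = (\<Sum>k=1..n. mpl_coeff (s # ss) k)"
  proof (rule sum.cong)
    fix k assume "k \<in> {1..n}"
    then have "{..k - 1} = {..<k}" by auto
    with \<open>k \<in> {1..n}\<close> show "entry_term (Plain s) k * (\<Sum>j\<le>k - 1. mpl_coeff ss j) = mpl_coeff (s # ss) k"
      by simp
  qed simp
  also have "\<dots> = (\<Sum>k\<le>n. mpl_coeff (s # ss) k)"
    by (intro sum.mono_neutral_left) auto
  finally show ?case .
qed

text \<open>The leading index is also the exponent of \<open>x\<close>, so a bar on the first entry
  alone amounts to evaluation at \<open>x = -1\<close>.\<close>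

lemma zeta_partial_Bar:
  "zeta_partial (Bar s # map Plain ss) n = (\<Sum>k\<le>n. mpl_coeff (s # ss) k * (-1) ^ k)"
proof -
  have "zeta_partial (Bar s # map Plain ss) n = (\<Sum>k=1..n. mpl_coeff (s # ss) k * (-1) ^ k)"
    unfolding zeta_partial_Cons
  proof (rule sum.cong)
    fix k assume "k \<in> {1..n}"
    then have "{..k - 1} = {..<k}" by auto
    with \<open>k \<in> {1..n}\<close> show "entry_term (Bar s) k * zeta_partial (map Plain ss) (k - 1)
        = mpl_coeff (s # ss) k * (-1) ^ k"
      by (simp add: zeta_partial_Plain)
  qed simp
  also have "\<dots> = (\<Sum>k\<le>n. mpl_coeff (s # ss) k * (-1) ^ k)"
    by (intro sum.mono_neutral_left) auto
  finally show ?thesis .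
qed

section \<open>Continuity up to the boundary point\<close>

text \<open>Multiplication by \<open>1 - x\<close> replaces the coefficients by their differences.
  These are absolutely summable, so the M-test gives continuity on the closed interval, and dividing
  by \<open>1 - x\<close> costs only the point 1.\<close>

lemma power_series_bounded_variation:
  fixes a :: "nat \<Rightarrow> real"
  assumes lim: "a \<longlonglongrightarrow> 0" and bv: "summable (\<lambda>n. \<bar>a (Suc n) - a n\<bar>)"
  shows "\<And>x. x \<in> {-1..<1} \<Longrightarrow> summable (\<lambda>n. a n * x ^ n)"
    and "continuous_on {-1..<1} (\<lambda>x. \<Sum>n. a n * x ^ n)"
proof -
  define d where "d n = (if n = 0 then a 0 else a n - a (n - 1))" for n
  have sd: "summable (\<lambda>n. \<bar>d n\<bar>)"
    by (subst summable_Suc_iff[symmetric]) (use bv in \<open>simp add: d_def\<close>)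
  have bound: "norm (d n * x ^ n) \<le> \<bar>d n\<bar>" if "x \<in> {-1..1}" for x n
    using that by (simp add: abs_mult power_abs mult_left_le power_le_one abs_le_iff)
  define D where "D x = (\<Sum>n. d n * x ^ n)" for x
  have D: "(\<lambda>n. d n * x ^ n) sums D x" if "x \<in> {-1..1}" for x
    unfolding D_def by (intro summable_sums summable_comparison_test[OF _ sd] exI[of _ 0])
      (use bound[OF that] in auto)
  have contD: "continuous_on {-1..1} D"
  proof (rule uniform_limit_theorem)
    show "uniform_limit {-1..1} (\<lambda>n x. \<Sum>i<n. d i * x ^ i) D sequentially"
      unfolding D_def by (rule Weierstrass_m_test[OF bound sd])
  qed (auto intro!: continuous_intros always_eventually)
  \<comment> \<open>Abel summation: the boundary term vanishes in the limit even at
    \<open>x = -1\<close>, because \<open>a\<close> tends to 0.\<close>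
  have parts: "(1 - x) * (\<Sum>k<n. a k * x ^ k) =
      (\<Sum>k<n. d k * x ^ k) - (if n = 0 then 0 else a (n - 1) * x ^ n)" for x n
    by (induction n) (auto simp: d_def algebra_simps)
  have sums: "(\<lambda>n. a n * x ^ n) sums (D x / (1 - x))" if x: "x \<in> {-1..<1}" for x
  proof -
    have "(\<lambda>n. a n * x ^ Suc n) \<longlonglongrightarrow> 0"
    proof (rule Lim_null_comparison[OF always_eventually])
      show "\<forall>n. norm (a n * x ^ Suc n) \<le> \<bar>a n\<bar>"
        using x by (auto simp: abs_mult power_abs abs_le_iff intro!: mult_left_le mult_le_one power_le_one)
      show "(\<lambda>n. \<bar>a n\<bar>) \<longlonglongrightarrow> 0"
        using lim by (rule tendsto_rabs_zero)
    qed
    then have "(\<lambda>n. if n = 0 then 0 else a (n - 1) * x ^ n) \<longlonglongrightarrow> 0"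
      by (subst filterlim_sequentially_Suc[symmetric]) simp
    then have "(\<lambda>n. ((\<Sum>k<n. d k * x ^ k) - (if n = 0 then 0 else a (n - 1) * x ^ n)) / (1 - x))
        \<longlonglongrightarrow> (D x - 0) / (1 - x)"
      using D[of x] x unfolding sums_def by (intro tendsto_intros) auto
    moreover have "((\<Sum>k<n. d k * x ^ k) - (if n = 0 then 0 else a (n - 1) * x ^ n)) / (1 - x)
        = (\<Sum>k<n. a k * x ^ k)" for n
      using x unfolding parts[symmetric] by simp
    ultimately show ?thesis
      unfolding sums_def by simp
  qed
  show "summable (\<lambda>n. a n * x ^ n)" if "x \<in> {-1..<1}" for x
    using sums[OF that] by (rule sums_summable)
  have "continuous_on {-1..<1} (\<lambda>x. D x / (1 - x))"
    by (intro continuous_intros continuous_on_subset[OF contD]) auto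
  then show "continuous_on {-1..<1} (\<lambda>x. \<Sum>n. a n * x ^ n)"
    by (rule continuous_on_eq) (use sums sums_unique in auto)
qed

section \<open>Decay and bounded variation of the coefficients\<close>

text \<open>Summation by parts with 1/((k+1)(k+2)) = 1/(k+1) - 1/(k+2).\<close>

lemma sum_by_parts_reciprocal:
  fixes c :: "nat \<Rightarrow> real"
  shows "(\<Sum>k<N. (\<Sum>j<Suc k. c j) / (real (k + 1) * real (k + 2))) + (\<Sum>j<N. c j) / real (N + 1)
    = (\<Sum>k<N. c k / real (k + 1))"
proof (induction N)
  case (Suc N)
  have "S / ((x + 1) * (x + 2)) + S / (x + 2) = S / (x + 1)" if "x \<ge> 0" for S x :: real
    using that by (simp add: divide_simps) (simp add: algebra_simps)
  from this[of "real N" "\<Sum>j<Suc N. c j"] Suc show ?case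
    by (simp add: add_divide_distrib algebra_simps)
qed simp

lemma mpl_coeff_Suc_le:
  assumes "s \<ge> 1"
  shows "mpl_coeff (s # ss) (Suc n) \<le> (\<Sum>j<Suc n. mpl_coeff ss j) / real (n + 1)"
proof -
  have "real (n + 1) ^ 1 \<le> real (n + 1) ^ s"
    using assms by (intro power_increasing) auto
  then show ?thesis
    by (auto intro!: divide_left_mono add_nonneg_nonneg sum_nonneg mpl_coeff_nonneg)
qed

text \<open>Summation by parts bounds the weighted sum for \<open>s # ss\<close> by the one for \<open>ss\<close>, which
  avoids any logarithmic growth estimate for the nested harmonic sums.\<close>

lemma sum_mpl_coeff_weighted_le_1:
  assumes "0 \<notin> set ss"
  shows "(\<Sum>k<N. (\<Sum>j<Suc k. mpl_coeff ss j) / (real (k + 1) * real (k + 2))) \<le> 1"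
  using assms
proof (induction ss arbitrary: N)
  case Nil
  have "(\<Sum>k<N. (\<Sum>j<Suc k. mpl_coeff [] j) / (real (k + 1) * real (k + 2)))
      \<le> (\<Sum>k<N. mpl_coeff [] k / real (k + 1))"
    unfolding sum_by_parts_reciprocal[symmetric] by (auto intro!: sum_nonneg)
  also have "\<dots> \<le> (\<Sum>k\<in>{0}. mpl_coeff [] k / real (k + 1))"
    by (cases N) (auto simp: sum.lessThan_Suc_shift simp del: sum.lessThan_Suc)
  finally show ?case by simp
next
  case (Cons s ss)
  have "(\<Sum>k<N. (\<Sum>j<Suc k. mpl_coeff (s # ss) j) / (real (k + 1) * real (k + 2)))
      \<le> (\<Sum>k<N. mpl_coeff (s # ss) k / real (k + 1))"
    unfolding sum_by_parts_reciprocal[symmetric]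
    by (simp add: sum_nonneg mpl_coeff_nonneg del: mpl_coeff.simps)
  also have "\<dots> \<le> (\<Sum>k<Suc N. mpl_coeff (s # ss) k / real (k + 1))"
    by (simp add: mpl_coeff_nonneg del: mpl_coeff.simps)
  \<comment> \<open>The coefficient at 0 vanishes. Shifting the index past it raises the denominator
    to \<open>k + 2\<close>, and the bound on the coefficient supplies the other factor of the
    weight.\<close>
  also have "\<dots> = (\<Sum>k<N. mpl_coeff (s # ss) (Suc k) / real (k + 2))"
    by (subst sum.lessThan_Suc_shift) simp
  also have "\<dots> \<le> (\<Sum>k<N. (\<Sum>j<Suc k. mpl_coeff ss j) / (real (k + 1) * real (k + 2)))"
  proof (rule sum_mono)
    fix k
    have "mpl_coeff (s # ss) (Suc k) \<le> (\<Sum>j<Suc k. mpl_coeff ss j) / real (k + 1)"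
      using Cons.prems by (intro mpl_coeff_Suc_le) auto
    then have "mpl_coeff (s # ss) (Suc k) / real (k + 2)
        \<le> (\<Sum>j<Suc k. mpl_coeff ss j) / real (k + 1) / real (k + 2)"
      by (intro divide_right_mono) auto
    then show "mpl_coeff (s # ss) (Suc k) / real (k + 2)
        \<le> (\<Sum>j<Suc k. mpl_coeff ss j) / (real (k + 1) * real (k + 2))"
      by (simp only: divide_divide_eq_left)
  qed
  also have "\<dots> \<le> 1"
    using Cons by simp
  finally show ?case .
qed

lemma summable_mpl_coeff_weighted:
  assumes "0 \<notin> set ss"
  shows "summable (\<lambda>k. (\<Sum>j<Suc k. mpl_coeff ss j) / (real (k + 1) * real (k + 2)))"
  by (rule summableI_nonneg_bounded[OF _ sum_mpl_coeff_weighted_le_1[OF assms]])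
     (auto intro!: divide_nonneg_nonneg sum_nonneg add_nonneg_nonneg mpl_coeff_nonneg)

text \<open>The weights from \<open>n\<close> onwards telescope to 1/(n+1). Since the prefix sums
  increase, the quotient is at most a tail of the convergent weighted series.\<close>

lemma sum_mpl_coeff_sublinear:
  assumes "0 \<notin> set ss"
  shows "(\<lambda>n. (\<Sum>j<Suc n. mpl_coeff ss j) / real (n + 1)) \<longlonglongrightarrow> 0"
proof -
  define H where "H n = (\<Sum>j<Suc n. mpl_coeff ss j)" for n
  define b where "b n = H n / (real (n + 1) * real (n + 2))" for n
  have sb: "summable b"
    using summable_mpl_coeff_weighted[OF assms] unfolding b_def H_def .
  have H_mono: "H m \<le> H n" if "m \<le> n" for m n
    unfolding H_def using that by (intro sum_mono2) (auto intro: mpl_coeff_nonneg)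
  have H_nonneg: "0 \<le> H n" for n
    unfolding H_def by (intro sum_nonneg mpl_coeff_nonneg)
  have "(\<lambda>i. 1 / real (i + 1)) \<longlonglongrightarrow> 0"
    using LIMSEQ_inverse_real_of_nat by (simp add: inverse_eq_divide)
  then have telescope: "(\<lambda>i. 1 / real (i + n + 1) - 1 / real (Suc i + n + 1)) sums (1 / real (0 + n + 1) - 0)"
    for n
    using LIMSEQ_ignore_initial_segment[of "\<lambda>i. 1 / real (i + 1)" 0 n]
    by (intro telescope_sums') simp
  have tail: "H n / real (n + 1) \<le> (\<Sum>i. b (i + n))" for n
  proof -
    have "(\<lambda>i. H n * (1 / real (i + n + 1) - 1 / real (Suc i + n + 1))) sums (H n / real (n + 1))"
      using sums_mult[OF telescope[of n], of "H n"] by simp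
    moreover have "H n * (1 / real (i + n + 1) - 1 / real (Suc i + n + 1)) \<le> b (i + n)" for i
    proof -
      have "1 / real (i + n + 1) - 1 / real (Suc i + n + 1) = 1 / (real (i + n + 1) * real (i + n + 2))"
        by (simp add: divide_simps)
      then show ?thesis
        unfolding b_def using H_mono[of n "i + n"] by (simp add: divide_right_mono)
    qed
    ultimately show ?thesis
      using sb by (intro sums_le[OF _ _ summable_sums]) (auto simp: summable_iff_shift)
  qed
  have "(\<lambda>n. H n / real (n + 1)) \<longlonglongrightarrow> 0"
  proof (rule tendsto_sandwich[OF _ _ tendsto_const])
    show "(\<lambda>n. \<Sum>i. b (i + n)) \<longlonglongrightarrow> 0"
      using suminf_exist_split2[OF sb] by simp
  qed (intro always_eventually allI divide_nonneg_nonneg H_nonneg tail of_nat_0_le_iff)+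
  then show ?thesis
    by (simp add: H_def)
qed

lemma mpl_coeff_tendsto_0:
  assumes "0 \<notin> set ss"
  shows "mpl_coeff ss \<longlonglongrightarrow> 0"
proof (cases ss)
  case Nil
  have "(\<lambda>n. mpl_coeff [] (Suc n)) \<longlonglongrightarrow> 0"
    by simp
  then show ?thesis
    unfolding Nil filterlim_sequentially_Suc .
next
  case (Cons s ss')
  have "(\<lambda>n. mpl_coeff (s # ss') (Suc n)) \<longlonglongrightarrow> 0"
    using assms Cons
    by (intro tendsto_sandwich[OF _ _ tendsto_const sum_mpl_coeff_sublinear[of ss']] always_eventually
        allI mpl_coeff_nonneg mpl_coeff_Suc_le) auto
  then show ?thesis
    unfolding Cons filterlim_sequentially_Suc .
qed

text \<open>Applied to consecutive reciprocals, this reduces exponent \<open>s\<close> to exponent 1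
  at the cost of a factor \<open>s\<close>.\<close>

lemma power_diff_le:
  fixes x y :: real
  assumes "0 \<le> y" "y \<le> x" "x \<le> 1"
  shows "x ^ s - y ^ s \<le> real s * (x - y)"
proof (induction s)
  case (Suc s)
  have "x ^ Suc s - y ^ Suc s = x ^ s * (x - y) + y * (x ^ s - y ^ s)"
    by (simp add: algebra_simps)
  also have "\<dots> \<le> 1 * (x - y) + 1 * (x ^ s - y ^ s)"
    using assms by (intro add_mono mult_right_mono power_le_one) (auto intro: power_mono)
  also have "\<dots> \<le> real (Suc s) * (x - y)"
    using Suc by (simp add: algebra_simps)
  finally show ?case .
qed simp

text \<open>A difference of neighbouring coefficients is a new summand of the inner sum minus the
  effect of the growing denominator. Both parts are nonnegative and bounded by terms of convergent
  weighted series, for \<open>tl ts\<close> and for \<open>ts\<close>. The comparison starts at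
  index 1, since index 0 follows a separate clause.\<close>

lemma mpl_coeff_bounded_variation:
  assumes "0 \<notin> set ss"
  shows "summable (\<lambda>n. \<bar>mpl_coeff ss (Suc n) - mpl_coeff ss n\<bar>)"
proof (cases ss)
  case Nil
  have "summable (\<lambda>n. \<bar>mpl_coeff [] (Suc (Suc n)) - mpl_coeff [] (Suc n)\<bar>)"
    by simp
  then show ?thesis
    unfolding Nil by (rule summable_Suc_iff[THEN iffD1])
next
  case (Cons s ts)
  define H where "H us n = (\<Sum>j<Suc n. mpl_coeff us j)" for us n
  define w where "w n = 1 / (real (n + 1) * real (n + 2))" for n
  have H_nonneg: "0 \<le> H us n" for us n
    unfolding H_def by (intro sum_nonneg mpl_coeff_nonneg)
  have ts: "0 \<notin> set ts" "0 \<notin> set (tl ts)" "s \<ge> 1"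
    using assms Cons by (auto, cases ts, auto)
  have increment: "mpl_coeff ts (Suc n) / real (n + 2) ^ s \<le> H (tl ts) n * w n" for n
  proof -
    have "real (n + 2) ^ 1 \<le> real (n + 2) ^ s"
      using ts by (intro power_increasing) auto
    then have "mpl_coeff ts (Suc n) / real (n + 2) ^ s \<le> mpl_coeff ts (Suc n) / real (n + 2)"
      by (intro divide_left_mono mpl_coeff_nonneg) auto
    also have "\<dots> \<le> H (tl ts) n / real (n + 1) / real (n + 2)"
    proof (rule divide_right_mono)
      show "mpl_coeff ts (Suc n) \<le> H (tl ts) n / real (n + 1)"
      \<comment> \<open>For empty \<open>ts\<close>, \<open>tl ts\<close> is empty too and the left
        side is 0.\<close>
      proof (cases ts)
        case Nil
        then show ?thesis using H_nonneg[of "[]"] by simp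
      next
        case (Cons t us)
        then show ?thesis
          using ts mpl_coeff_Suc_le[of t us n] by (auto simp: H_def simp del: mpl_coeff.simps)
      qed
    qed simp
    finally show ?thesis
      by (simp add: w_def)
  qed
  have decay: "H ts n * (1 / real (n + 1) ^ s - 1 / real (n + 2) ^ s) \<le> real s * (H ts n * w n)"
    and decay_nonneg: "0 \<le> H ts n * (1 / real (n + 1) ^ s - 1 / real (n + 2) ^ s)" for n
  proof -
    have "(1 / real (n + 1)) ^ s - (1 / real (n + 2)) ^ s \<le> real s * (1 / real (n + 1) - 1 / real (n + 2))"
      by (intro power_diff_le) (auto simp: frac_le)
    also have "1 / real (n + 1) - 1 / real (n + 2) = w n"
      by (simp add: w_def divide_simps)
    finally show "H ts n * (1 / real (n + 1) ^ s - 1 / real (n + 2) ^ s) \<le> real s * (H ts n * w n)"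
      using mult_left_mono[OF _ H_nonneg[of ts n]] by (fastforce simp: power_one_over mult.left_commute)
    have "real (n + 1) ^ s \<le> real (n + 2) ^ s"
      by (intro power_mono) auto
    then show "0 \<le> H ts n * (1 / real (n + 1) ^ s - 1 / real (n + 2) ^ s)"
      by (intro mult_nonneg_nonneg H_nonneg) (auto intro!: divide_left_mono)
  qed
  have "\<bar>mpl_coeff ss (Suc (Suc n)) - mpl_coeff ss (Suc n)\<bar> \<le> H (tl ts) n * w n + real s * (H ts n * w n)" for n
  proof -
    have "mpl_coeff ss (Suc (Suc n)) - mpl_coeff ss (Suc n)
        = mpl_coeff ts (Suc n) / real (n + 2) ^ s
          - H ts n * (1 / real (n + 1) ^ s - 1 / real (n + 2) ^ s)"
      by (simp add: Cons H_def add_divide_distrib algebra_simps)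
    moreover have "0 \<le> mpl_coeff ts (Suc n) / real (n + 2) ^ s"
      by (intro divide_nonneg_nonneg mpl_coeff_nonneg) auto
    ultimately show ?thesis
      using increment[of n] decay[of n] decay_nonneg[of n] by linarith
  qed
  moreover have "summable (\<lambda>n. H (tl ts) n * w n + real s * (H ts n * w n))"
    using summable_mpl_coeff_weighted[OF ts(1)] summable_mpl_coeff_weighted[OF ts(2)]
    by (intro summable_add summable_mult) (simp_all add: H_def w_def)
  ultimately have "summable (\<lambda>n. \<bar>mpl_coeff ss (Suc (Suc n)) - mpl_coeff ss (Suc n)\<bar>)"
    by (intro summable_comparison_test[of "\<lambda>n. \<bar>mpl_coeff ss (Suc (Suc n)) - mpl_coeff ss (Suc n)\<bar>"])
       (auto simp: Cons simp del: mpl_coeff.simps)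
  then show ?thesis
    by (rule summable_Suc_iff[THEN iffD1])
qed

lemma
  assumes "0 \<notin> set ss"
  shows summable_mpl: "x \<in> {-1..<1} \<Longrightarrow> summable (\<lambda>n. mpl_coeff ss n * x ^ n)"
    and continuous_on_mpl: "continuous_on {-1..<1} (mpl ss)"
  using power_series_bounded_variation[OF mpl_coeff_tendsto_0 mpl_coeff_bounded_variation, OF assms assms]
  unfolding mpl_def[abs_def] by auto

lemma mzeta_Bar:
  assumes "s \<ge> 1" "0 \<notin> set ss"
  shows "mzeta (Bar s # map Plain ss) = mpl (s # ss) (-1)"
proof -
  \<comment> \<open>\<open>lim\<close> is informative only for a convergent sequence, so convergence
    at the boundary point comes first.\<close>
  have "summable (\<lambda>n. mpl_coeff (s # ss) n * (-1) ^ n)"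
    using assms by (intro summable_mpl) auto
  then have "(\<lambda>n. \<Sum>k\<le>n. mpl_coeff (s # ss) k * (-1) ^ k) \<longlonglongrightarrow> mpl (s # ss) (-1)"
    unfolding mpl_def by (rule summable_LIMSEQ')
  then show ?thesis
    unfolding mzeta_def zeta_partial_Bar[abs_def] by (rule limI)
qed

section \<open>Differential equations\<close>

lemma
  assumes "0 \<notin> set ss" "x \<in> {-1<..<1}"
  shows mpl_has_derivative_series:
      "(mpl ss has_real_derivative (\<Sum>n. diffs (mpl_coeff ss) n * x ^ n)) (at x)"
    and summable_mpl_derivative: "summable (\<lambda>n. diffs (mpl_coeff ss) n * x ^ n)"
proof -
  have sm: "summable (\<lambda>n. mpl_coeff ss n * z ^ n)" if "norm z < 1" for z
    using that by (intro summable_mpl assms) auto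
  show "(mpl ss has_real_derivative (\<Sum>n. diffs (mpl_coeff ss) n * x ^ n)) (at x)"
    unfolding mpl_def[abs_def] by (rule termdiffs_strong'[OF sm]) (use assms in auto)
  show "summable (\<lambda>n. diffs (mpl_coeff ss) n * x ^ n)"
    by (rule termdiff_converges[OF _ sm]) (use assms in auto)
qed

text \<open>The operator x d/dx multiplies the coefficient of \<open>x ^ n\<close> by
  \<open>n\<close>, which lowers the leading exponent by one.\<close>

lemma mpl_has_derivative:
  assumes "s \<ge> 2" "0 \<notin> set ss" "x \<in> {-1<..<1}" "x \<noteq> 0"
  shows "(mpl (s # ss) has_real_derivative mpl ((s - 1) # ss) x / x) (at x)"
proof -
  let ?c = "mpl_coeff (s # ss)" and ?d = "mpl_coeff ((s - 1) # ss)"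
  have "0 \<notin> set (s # ss)"
    using assms by auto
  note D = mpl_has_derivative_series[OF this assms(3)] and S = summable_mpl_derivative[OF this assms(3)]
  obtain t where t: "s = Suc t"
    using assms by (cases s) auto
  have "x * (diffs ?c n * x ^ n) = ?d (Suc n) * x ^ Suc n" for n
    by (simp add: diffs_def t del: sum.lessThan_Suc of_nat_Suc)
  then have "(\<lambda>n. ?d (Suc n) * x ^ Suc n) sums (x * (\<Sum>n. diffs ?c n * x ^ n))"
    using sums_mult[OF summable_sums[OF S], of x] by (simp only:)
  then have "(\<lambda>n. ?d n * x ^ n) sums (x * (\<Sum>n. diffs ?c n * x ^ n) + ?d 0 * x ^ 0)"
    by (rule sums_Suc)
  then have "mpl ((s - 1) # ss) x = x * (\<Sum>n. diffs ?c n * x ^ n)"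
    unfolding mpl_def by (simp add: sums_iff)
  with D assms(4) show ?thesis
    by simp
qed

text \<open>The derivative has the prefix sums \<open>H\<close> as coefficients; multiplication by
  \<open>1 - x\<close> takes their differences and recovers the series of \<open>ss\<close>.\<close>

lemma mpl_1_has_derivative:
  assumes "0 \<notin> set ss" "x \<in> {-1<..<1}"
  shows "(mpl (1 # ss) has_real_derivative mpl ss x / (1 - x)) (at x)"
proof -
  let ?c = "mpl_coeff (1 # ss)"
  define H where "H n = (\<Sum>j<Suc n. mpl_coeff ss j)" for n
  have "0 \<notin> set (1 # ss)"
    using assms by auto
  note D = mpl_has_derivative_series[OF this assms(2)] and S = summable_mpl_derivative[OF this assms(2)]
  define T where "T = (\<Sum>n. diffs ?c n * x ^ n)"
  have diffs: "diffs ?c = H"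
    by (rule ext) (simp add: diffs_def H_def del: sum.lessThan_Suc of_nat_Suc)
  have T: "(\<lambda>n. H n * x ^ n) sums T"
    using summable_sums[OF S] unfolding T_def diffs .
  then have "(\<lambda>n. H (Suc n) * x ^ Suc n) sums (T - H 0)"
    by (subst sums_Suc_iff) simp
  from sums_diff[OF this sums_mult[OF T, of x]]
  have "(\<lambda>n. mpl_coeff ss (Suc n) * x ^ Suc n) sums (T - H 0 - x * T)"
    by (simp add: H_def algebra_simps)
  then have "(\<lambda>n. mpl_coeff ss n * x ^ n) sums (T - H 0 - x * T + mpl_coeff ss 0 * x ^ 0)"
    by (rule sums_Suc)
  then have "mpl ss x = (1 - x) * T"
    unfolding mpl_def by (simp add: sums_iff H_def algebra_simps)
  with D assms(2) show ?thesis
    unfolding T_def[symmetric] by simp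
qed

section \<open>Powers of the logarithm as polylogarithms of ones\<close>

definition neg_ln_power :: "nat \<Rightarrow> real \<Rightarrow> real" where
  "neg_ln_power n x = (- ln (1 - x)) ^ n / fact n"

lemma neg_ln_power_0 [simp]: "neg_ln_power 0 x = 1"
  by (simp add: neg_ln_power_def)

lemma neg_ln_power_has_derivative:
  assumes "x < 1"
  shows "(neg_ln_power n has_real_derivative (case n of 0 \<Rightarrow> 0 | Suc i \<Rightarrow> neg_ln_power i x / (1 - x))) (at x)"
proof (cases n)
  case (Suc i)
  have "((\<lambda>x. (- ln (1 - x)) ^ n / fact n) has_real_derivative
      real n * (- ln (1 - x)) ^ (n - 1) * (1 / (1 - x)) / fact n) (at x)"
    using assms by (intro DERIV_cdivide) (auto intro!: derivative_eq_intros simp: divide_simps)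
  moreover have "real n * (- ln (1 - x)) ^ (n - 1) * (1 / (1 - x)) / fact n = neg_ln_power i x / (1 - x)"
    by (simp add: Suc neg_ln_power_def divide_simps del: of_nat_Suc)
  ultimately show ?thesis
    unfolding neg_ln_power_def[abs_def] by (simp only: Suc nat.case)
qed (simp add: neg_ln_power_def[abs_def])

lemma continuous_on_neg_ln_power: "continuous_on {-1..<1} (neg_ln_power n)"
  by (rule DERIV_continuous_on[where D = "\<lambda>x. case n of 0 \<Rightarrow> 0 | Suc i \<Rightarrow> neg_ln_power i x / (1 - x)"])
     (use neg_ln_power_has_derivative in \<open>auto intro: has_field_derivative_at_within\<close>)

text \<open>Both sides vanish at 0 for positive \<open>n\<close> and obey the same recursion: the
  derivative is the preceding function divided by \<open>1 - x\<close>.\<close>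

lemma mpl_ones:
  assumes "x \<in> {-1..0}"
  shows "mpl (replicate n 1) x = neg_ln_power n x"
  using assms
proof (induction n arbitrary: x)
  case 0
  have "mpl [] x = (\<Sum>n\<in>{0}. mpl_coeff [] n * x ^ n)"
    unfolding mpl_def by (rule suminf_finite) auto
  then show ?case by simp
next
  case (Suc n)
  define f where "f x = mpl (replicate (Suc n) 1) x - neg_ln_power (Suc n) x" for x
  have "f x = f 0"
  proof (cases "x = 0")
    case False
    show ?thesis
    \<comment> \<open>Derivatives are needed only in the open interval; continuity covers the
      endpoint, in particular \<open>x = -1\<close>.\<close>
    proof (rule DERIV_isconst_end[where f = f, symmetric])
      show "continuous_on {x..0} f"
        unfolding f_def[abs_def]
        by (rule continuous_on_subset[of "{-1..<1}"])
           (use Suc.prems in \<open>auto intro!: continuous_on_diff continuous_on_mpl continuous_on_neg_ln_power\<close>)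
      fix y assume y: "x < y" "y < 0"
      have "((\<lambda>x. mpl (1 # replicate n 1) x - neg_ln_power (Suc n) x) has_real_derivative
          mpl (replicate n 1) y / (1 - y) - neg_ln_power n y / (1 - y)) (at y)"
        using y Suc.prems neg_ln_power_has_derivative[of y "Suc n"]
        by (intro derivative_intros mpl_1_has_derivative) auto
      then show "(f has_real_derivative 0) (at y)"
        using Suc.IH[of y] y Suc.prems by (simp add: f_def[abs_def])
    qed (use False Suc.prems in auto)
  qed simp
  then show ?case
    by (simp add: f_def mpl_at_0 neg_ln_power_def)
qed

section \<open>The primitive and its boundary values\<close>

text \<open>After the product rule, \<open>a' (m - j) * r j\<close> and
  \<open>a (m - j - 1) * r' (j + 1)\<close> both equal \<open>q * a (m - j - 1) * r j\<close> and
  carry opposite signs. Only the term with \<open>r' 0\<close> survives, as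
  \<open>a' 0 = 0\<close>.\<close>

lemma alternating_convolution_derivative:
  fixes a a' r r' :: "nat \<Rightarrow> 'a::comm_ring_1"
  assumes "a' 0 = 0" "\<And>i. a' (Suc i) = q * a i" "\<And>j. r' (Suc j) = q * r j"
  shows "(\<Sum>j\<le>m. (-1) ^ j * (a' (m - j) * r j + a (m - j) * r' j)) = a m * r' 0"
proof (cases m)
  case (Suc n)
  have "(\<Sum>j\<le>m. (-1) ^ j * (a' (m - j) * r j)) = (\<Sum>j\<le>n. (-1) ^ j * (q * a (n - j) * r j))"
    by (auto simp: Suc assms Suc_diff_le intro!: sum.cong)
  moreover have "(\<Sum>j\<le>m. (-1) ^ j * (a (m - j) * r' j))
      = a m * r' 0 - (\<Sum>j\<le>n. (-1) ^ j * (q * a (n - j) * r j))"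
    unfolding Suc by (subst sum.atMost_Suc_shift) (simp add: assms sum_negf mult_ac)
  ultimately show ?thesis
    by (simp add: distrib_left sum.distrib)
qed (simp add: assms)

definition mpl_3 :: "nat \<Rightarrow> nat \<Rightarrow> real \<Rightarrow> real" where
  "mpl_3 j k = mpl (replicate j 1 @ 3 # replicate (k - 1) 1)"

definition mpl_convolution :: "nat \<Rightarrow> nat \<Rightarrow> real \<Rightarrow> real" where
  "mpl_convolution m k x = (\<Sum>j\<le>m. (-1) ^ j * (neg_ln_power (m - j) x * mpl_3 j k x))"

lemma continuous_on_mpl_3: "continuous_on {-1..<1} (mpl_3 j k)"
  unfolding mpl_3_def by (intro continuous_on_mpl) auto

lemma continuous_on_mpl_convolution: "continuous_on {-1..<1} (mpl_convolution m k)"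
  unfolding mpl_convolution_def[abs_def]
  by (intro continuous_intros continuous_on_neg_ln_power continuous_on_mpl_3)

lemma mpl_convolution_at_0: "mpl_convolution m k 0 = 0"
proof -
  have "mpl_3 j k 0 = 0" for j
    by (cases j) (simp_all add: mpl_3_def mpl_at_0)
  then show ?thesis
    by (simp add: mpl_convolution_def)
qed

text \<open>The cancellation applies with \<open>q = 1 / (1 - x)\<close>. The surviving term is the
  derivative of \<open>mpl_3 0 k\<close>, where the leading 3 drops to 2.\<close>

lemma mpl_convolution_has_derivative:
  assumes "x \<in> {-1<..<0}"
  shows "(mpl_convolution m k has_real_derivative
    neg_ln_power m x * (mpl (2 # replicate (k - 1) 1) x / x)) (at x)"
proof -
  define a' where "a' n = (case n of 0 \<Rightarrow> 0 | Suc i \<Rightarrow> neg_ln_power i x / (1 - x))" for n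
  define r' where "r' n = (case n of 0 \<Rightarrow> mpl (2 # replicate (k - 1) 1) x / x
    | Suc j \<Rightarrow> mpl_3 j k x / (1 - x))" for n
  have da: "(neg_ln_power n has_real_derivative a' n) (at x)" for n
    unfolding a'_def by (rule neg_ln_power_has_derivative) (use assms in auto)
  have dr: "(mpl_3 j k has_real_derivative r' j) (at x)" for j
  proof (cases j)
    case 0
    show ?thesis
      using mpl_has_derivative[of 3 "replicate (k - 1) 1" x] assms by (simp add: 0 mpl_3_def r'_def)
  next
    case (Suc i)
    show ?thesis
      using mpl_1_has_derivative[of "replicate i 1 @ 3 # replicate (k - 1) 1" x] assms
      by (simp add: Suc mpl_3_def r'_def)
  qed
  have "(mpl_convolution m k has_real_derivative
      (\<Sum>j\<le>m. (-1) ^ j * (a' (m - j) * mpl_3 j k x + neg_ln_power (m - j) x * r' j))) (at x)"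
    unfolding mpl_convolution_def[abs_def]
    by (auto intro!: derivative_eq_intros da dr sum.cong simp: algebra_simps)
  also have "(\<Sum>j\<le>m. (-1) ^ j * (a' (m - j) * mpl_3 j k x + neg_ln_power (m - j) x * r' j))
      = neg_ln_power m x * r' 0"
    by (rule alternating_convolution_derivative[where q = "1 / (1 - x)"]) (auto simp: a'_def r'_def)
  finally show ?thesis
    by (simp add: r'_def)
qed

lemma mpl_2_has_derivative:
  assumes "x \<in> {-1<..<0}" "m \<ge> 1"
  shows "(mpl (2 # replicate (m - 1) 1) has_real_derivative neg_ln_power m x / x) (at x)"
proof -
  have "1 # replicate (m - 1) 1 = replicate m (1::nat)"
    using assms(2) by (cases m) auto
  then show ?thesis
    using mpl_has_derivative[of 2 "replicate (m - 1) 1" x] mpl_ones[of x m] assms(1) by simp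
qed

text \<open>By the product rule the two sides, as functions of \<open>x\<close>, have equal
  derivatives inside the interval, and both vanish at 0.\<close>

lemma mpl_2_product:
  assumes "m \<ge> 1" "k \<ge> 1"
  shows "mpl (2 # replicate (m - 1) 1) (-1) * mpl (2 # replicate (k - 1) 1) (-1)
    = mpl_convolution m k (-1) + mpl_convolution k m (-1)"
proof -
  let ?P = "\<lambda>n. mpl (2 # replicate (n - 1) 1)"
  define F where "F x = ?P m x * ?P k x - mpl_convolution m k x - mpl_convolution k m x" for x
  have "F 0 = F (-1)"
  proof (rule DERIV_isconst_end[where f = F])
    show "continuous_on {-1..0} F"
      unfolding F_def[abs_def]
      by (rule continuous_on_subset[of "{-1..<1}"])
         (auto intro!: continuous_intros continuous_on_mpl continuous_on_mpl_convolution)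
    fix x :: real assume "-1 < x" "x < 0"
    then have x: "x \<in> {-1<..<0}" by simp
    have "(F has_real_derivative
        (neg_ln_power m x / x * ?P k x + neg_ln_power k x / x * ?P m x)
        - neg_ln_power m x * (?P k x / x) - neg_ln_power k x * (?P m x / x)) (at x)"
      unfolding F_def[abs_def]
      by (intro DERIV_diff DERIV_mult mpl_2_has_derivative mpl_convolution_has_derivative x assms)
    then show "(F has_real_derivative 0) (at x)"
      by (simp add: mult.commute)
  qed simp
  then show ?thesis
    by (simp add: F_def mpl_convolution_at_0 mpl_at_0)
qed

section \<open>Translation into zeta values\<close>

text \<open>For positive \<open>j\<close> the bar falls on an initial 1; for \<open>j = 0\<close> it
  would fall on the 3, the source of the separate \<open>Bar 3\<close> terms.\<close>

lemma mzeta_Bar_mpl_3: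
  assumes "j \<ge> 1"
  shows "mzeta ([Bar 1] @ ones (j - 1) @ [Plain 3] @ ones (k - 1)) = mpl_3 j k (-1)"
proof -
  have "replicate j 1 = (1::nat) # replicate (j - 1) 1"
    using assms by (cases j) auto
  then show ?thesis
    using mzeta_Bar[of 1 "replicate (j - 1) 1 @ 3 # replicate (k - 1) 1"] by (simp add: mpl_3_def)
qed

lemma mpl_convolution_boundary:
  assumes "m \<ge> 1"
  shows "mpl_convolution m k (-1) =
    (-1) ^ m * mzeta ([Bar 1] @ ones (m - 1) @ [Plain 3] @ ones (k - 1))
    + (-1) ^ m * (\<Sum>i=1..m - 1. ln 2 ^ i / fact i
        * mzeta ([Bar 1] @ ones (m - i - 1) @ [Plain 3] @ ones (k - 1)))
    + (-1) ^ m / fact m * ln 2 ^ m * mzeta ([Bar 3] @ ones (k - 1))"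
proof -
  define g where "g i = ln 2 ^ i / fact i * mpl_3 (m - i) k (-1)" for i
  \<comment> \<open>Reversal makes \<open>i\<close> the power of \<open>ln 2\<close>. The sign of
    \<open>(- ln 2) ^ i\<close> then combines with \<open>(-1) ^ (m - i)\<close> to the constant
    \<open>(-1) ^ m\<close>.\<close>
  have "mpl_convolution m k (-1) = (\<Sum>i\<le>m. (-1) ^ (m - i) * (neg_ln_power i (-1) * mpl_3 (m - i) k (-1)))"
    unfolding mpl_convolution_def
    by (rule sum.reindex_bij_witness[of _ "\<lambda>i. m - i" "\<lambda>i. m - i"]) auto
  also have "\<dots> = (\<Sum>i\<le>m. (-1) ^ m * g i)"
  proof (rule sum.cong)
    fix i assume "i \<in> {..m}"
    then have "(-1::real) ^ m = (-1) ^ (m - i) * (-1) ^ i"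
      by (simp flip: power_add)
    then show "(-1) ^ (m - i) * (neg_ln_power i (-1) * mpl_3 (m - i) k (-1)) = (-1) ^ m * g i"
      by (simp add: g_def neg_ln_power_def power_minus[of "ln 2"])
  qed simp
  \<comment> \<open>The end terms are the full-length \<open>Bar 1\<close> value at
    \<open>i = 0\<close> and the \<open>Bar 3\<close> value at \<open>i = m\<close>; they are
    distinct because \<open>m\<close> is positive.\<close>
  also have "{..m} = insert 0 (insert m {1..m - 1})"
    using assms by auto
  also have "(\<Sum>i\<in>insert 0 (insert m {1..m - 1}). (-1) ^ m * g i)
      = (-1) ^ m * g 0 + (-1) ^ m * (\<Sum>i=1..m - 1. g i) + (-1) ^ m * g m"
    using assms by (simp add: sum_distrib_left)
  also have "g 0 = mzeta ([Bar 1] @ ones (m - 1) @ [Plain 3] @ ones (k - 1))"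
    using mzeta_Bar_mpl_3[OF assms] by (simp add: g_def)
  also have "(\<Sum>i=1..m - 1. g i) = (\<Sum>i=1..m - 1. ln 2 ^ i / fact i
        * mzeta ([Bar 1] @ ones (m - i - 1) @ [Plain 3] @ ones (k - 1)))"
    by (intro sum.cong refl, subst mzeta_Bar_mpl_3) (auto simp: g_def)
  also have "g m = ln 2 ^ m / fact m * mzeta ([Bar 3] @ ones (k - 1))"
    using mzeta_Bar[of 3 "replicate (k - 1) 1"] by (simp add: g_def mpl_3_def)
  finally show ?thesis
    by simp
qed

theorem theorem2p4:
  fixes m k :: nat
  assumes "m \<ge> 1" and "k \<ge> 1"
  shows
    "(-1) ^ m * mzeta ([Bar 1] @ ones (m - 1) @ [Plain 3] @ ones (k - 1))
     + (-1) ^ k * mzeta ([Bar 1] @ ones (k - 1) @ [Plain 3] @ ones (m - 1))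
     = (-1) ^ (m + 1) / fact m * ln 2 ^ m * mzeta ([Bar 3] @ ones (k - 1))
     + (-1) ^ (k + 1) / fact k * ln 2 ^ k * mzeta ([Bar 3] @ ones (m - 1))
     + mzeta ([Bar 2] @ ones (m - 1)) * mzeta ([Bar 2] @ ones (k - 1))
     + (-1) ^ (m + 1) * (\<Sum>i = 1..m - 1. ln 2 ^ i / fact i
         * mzeta ([Bar 1] @ ones (m - i - 1) @ [Plain 3] @ ones (k - 1)))
     + (-1) ^ (k + 1) * (\<Sum>i = 1..k - 1. ln 2 ^ i / fact i
         * mzeta ([Bar 1] @ ones (k - i - 1) @ [Plain 3] @ ones (m - 1)))"
proof -
  have "mzeta ([Bar 2] @ ones (n - 1)) = mpl (2 # replicate (n - 1) 1) (-1)" for n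
    using mzeta_Bar[of 2 "replicate (n - 1) 1"] by simp
  \<comment> \<open>Solving for the two \<open>i = 0\<close> terms moves all others across, which
    turns their signs into \<open>(-1) ^ (m + 1)\<close> and \<open>(-1) ^ (k + 1)\<close>.\<close>
  with mpl_2_product[OF assms] show ?thesis
    unfolding mpl_convolution_boundary[OF assms(1)] mpl_convolution_boundary[OF assms(2)]
    by simp
qed

end
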